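(* Let $X$ be a random variable with Weibull distribution $Weib(\eta,\gamma)$, where $\eta>0$ and $\gamma\in(1,2)$. Then for all $h\ge0$, $$E[X\mid X\ge h]\le E[X]+h .$$
   Context: The Weibull distribution $Weib(\eta,\gamma)$ with scale $\eta>0$ and shape $\gamma>0$ has density $f(t)=\frac{\gamma}{\eta}\left(\frac t\eta\right)^{\gamma-1}\exp\left(-\left(\frac t\eta\right)^\gamma\right)$ on $t>0$. *)

theory Defs
  imports "HOL-Probability.Probability"
begin

text \<open>Scale \<open>\<eta>\<close> comes first, shape \<open>\<gamma>\<close> second.\<close>

definition weibull_density :: "real \<Rightarrow> real \<Rightarrow> real \<Rightarrow> real" where
  "weibull_density \<eta> \<gamma> t =
     (if t > 0 then \<gamma> / \<eta> * (t / \<eta>) powr (\<gamma> - 1) * exp (- ((t / \<eta>) powr \<gamma>)) else 0)"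

text \<open>
  The elementary conditional expectation \<open>E[X | A] = E[X 1_A] / P(A)\<close> given an event of
  positive probability, as opposed to conditioning on a sub-\<open>\<sigma>\<close>-algebra (\<open>real_cond_exp\<close>).
  It is meaningful only if \<open>X\<close> is integrable on \<open>A\<close> and \<open>P(A) > 0\<close>; both hold when \<open>X\<close> is
  Weibull distributed and \<open>A\<close> is the event \<open>X \<ge> h\<close>.
\<close>

definition event_cond_exp :: "'a measure \<Rightarrow> ('a \<Rightarrow> real) \<Rightarrow> 'a set \<Rightarrow> real" where
  "event_cond_exp M X A = (LINT \<omega>:A|M. X \<omega>) / measure M A"

end

theory Submission
  imports Defs "HOL-Real_Asymp.Real_Asymp"
begin

text \<open>
  The tail \<open>S t = P(X \<ge> t) = exp (- (t / \<eta>) powr \<gamma>)\<close> is submultiplicative, because \<open>u powr \<gamma>\<close> is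
  superadditive in \<open>u\<close> for \<open>\<gamma> \<ge> 1\<close>. Hence \<open>E[(X - h)\<^sup>+]\<close>, which is the integral of \<open>S (h + t)\<close> over
  \<open>t \<ge> 0\<close>, is at most \<open>S h\<close> times the integral of \<open>S\<close>, that is, at most \<open>P(X \<ge> h) E[X]\<close>. Dividing by
  \<open>P(X \<ge> h)\<close> gives \<open>E[X - h | X \<ge> h] \<le> E[X]\<close>.
\<close>

lemma powr_superadditive:
  fixes a b p :: real
  assumes "0 \<le> a" "0 \<le> b" "1 \<le> p"
  shows "a powr p + b powr p \<le> (a + b) powr p"
proof -
  \<comment> \<open>One factor is pulled out of each power because the remaining exponent
    \<open>p - 1\<close> is nonnegative, so enlarging the base to \<open>a + b\<close> only
    increases the term. At \<open>x = 0\<close> both sides are 0.\<close>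
  have split: "x powr p = x * x powr (p - 1)" if "0 \<le> x" for x :: real
    using powr_mult_base[OF that, of "p - 1"] by simp
  have "a powr p + b powr p = a * a powr (p - 1) + b * b powr (p - 1)"
    using assms by (simp add: split[symmetric])
  also have "\<dots> \<le> a * (a + b) powr (p - 1) + b * (a + b) powr (p - 1)"
    using assms by (intro add_mono mult_left_mono powr_mono2) auto
  also have "\<dots> = (a + b) powr p"
    using assms by (simp add: split distrib_right)
  finally show ?thesis .
qed

text \<open>Layer-cake formula: the excess is the length of \<open>{0..X \<omega> - h}\<close>, and
  Tonelli swaps length and probability. Since \<open>ennreal\<close> sends negative reals to 0, the
  left side is the expected positive part of \<open>X - h\<close>, and \<open>h\<close> may have any
  sign.\<close>

lemma (in prob_space) nn_integral_excess_eq_tail: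
  assumes [measurable]: "random_variable borel X"
  shows "(\<integral>\<^sup>+\<omega>. ennreal (X \<omega> - h) \<partial>M)
    = (\<integral>\<^sup>+t. ennreal (prob {\<omega> \<in> space M. h + t \<le> X \<omega>}) * indicator {0..} t \<partial>lborel)"
proof -
  interpret pair_sigma_finite M lborel ..
  have "(\<integral>\<^sup>+\<omega>. ennreal (X \<omega> - h) \<partial>M) = (\<integral>\<^sup>+\<omega>. (\<integral>\<^sup>+t. indicator {0..X \<omega> - h} t \<partial>lborel) \<partial>M)"
    by (intro nn_integral_cong) (auto simp: emeasure_lborel_Icc_eq ennreal_neg)
  also have "\<dots> = (\<integral>\<^sup>+\<omega>. (\<integral>\<^sup>+t. (if 0 \<le> t \<and> h + t \<le> X \<omega> then 1 else 0) \<partial>lborel) \<partial>M)"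
    by (intro nn_integral_cong) (auto simp: indicator_def)
  also have "\<dots> = (\<integral>\<^sup>+t. (\<integral>\<^sup>+\<omega>. (if 0 \<le> t \<and> h + t \<le> X \<omega> then 1 else 0) \<partial>M) \<partial>lborel)"
    by (rule Fubini'[symmetric]) measurable
  also have "\<dots> = (\<integral>\<^sup>+t. ennreal (prob {\<omega> \<in> space M. h + t \<le> X \<omega>}) * indicator {0..} t \<partial>lborel)"
  proof (intro nn_integral_cong)
    fix t :: real
    have "(\<integral>\<^sup>+\<omega>. (if 0 \<le> t \<and> h + t \<le> X \<omega> then 1 else 0) \<partial>M)
      = (\<integral>\<^sup>+\<omega>. indicator {0..} t * indicator {\<omega> \<in> space M. h + t \<le> X \<omega>} \<omega> \<partial>M)"
      by (intro nn_integral_cong) (auto simp: indicator_def)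
    also have "\<dots> = ennreal (prob {\<omega> \<in> space M. h + t \<le> X \<omega>}) * indicator {0..} t"
      by (simp add: nn_integral_cmult emeasure_eq_measure mult.commute)
    finally show "(\<integral>\<^sup>+\<omega>. (if 0 \<le> t \<and> h + t \<le> X \<omega> then 1 else 0) \<partial>M)
      = ennreal (prob {\<omega> \<in> space M. h + t \<le> X \<omega>}) * indicator {0..} t" .
  qed
  finally show ?thesis .
qed

text \<open>Isolates the property of the law that drives the bound; when it holds for every
  nonnegative \<open>h\<close>, it is known in reliability theory as "new better than used".\<close>

lemma (in prob_space) event_cond_exp_le_if_tail_submultiplicative:
  assumes X: "integrable M X" and nonneg: "AE \<omega> in M. 0 \<le> X \<omega>"
    and pos: "0 < prob {\<omega> \<in> space M. h \<le> X \<omega>}"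
    and submult: "\<And>t. 0 \<le> t \<Longrightarrow> prob {\<omega> \<in> space M. h + t \<le> X \<omega>}
      \<le> prob {\<omega> \<in> space M. h \<le> X \<omega>} * prob {\<omega> \<in> space M. t \<le> X \<omega>}"
  shows "event_cond_exp M X {\<omega> \<in> space M. h \<le> X \<omega>} \<le> expectation X + h"
proof -
  have [measurable]: "random_variable borel X"
    using X by simp
  let ?A = "{\<omega> \<in> space M. h \<le> X \<omega>}"
  \<comment> \<open>The layer-cake formula is used twice: at \<open>h\<close> to pass to tails, and
    then backwards at threshold 0, hence the form \<open>0 + t\<close>, to recover the expectation
    of \<open>X\<close>.\<close>
  have "(\<integral>\<^sup>+\<omega>. ennreal (X \<omega> - h) \<partial>M)
      \<le> (\<integral>\<^sup>+t. ennreal (prob ?A) * (ennreal (prob {\<omega> \<in> space M. 0 + t \<le> X \<omega>}) * indicator {0..} t) \<partial>lborel)"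
    unfolding nn_integral_excess_eq_tail[OF \<open>random_variable borel X\<close>]
    by (intro nn_integral_mono)
      (auto simp: indicator_def submult ennreal_mult''[symmetric] intro!: ennreal_leI)
  also have "\<dots> = ennreal (prob ?A) * (\<integral>\<^sup>+\<omega>. ennreal (X \<omega> - 0) \<partial>M)"
    unfolding nn_integral_excess_eq_tail[OF \<open>random_variable borel X\<close>]
    by (intro nn_integral_cmult) measurable
  also have "\<dots> = ennreal (prob ?A * expectation X)"
    using X nonneg by (simp add: nn_integral_eq_integral ennreal_mult')
  finally have le: "(\<integral>\<^sup>+\<omega>. ennreal (X \<omega> - h) \<partial>M) \<le> ennreal (prob ?A * expectation X)" .
  have int: "integrable M (\<lambda>\<omega>. indicator ?A \<omega> * (X \<omega> - h))"
    using X by (intro integrable_mult_indicator[where 'b=real, simplified]) auto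
  have "ennreal (\<integral>\<omega>. indicator ?A \<omega> * (X \<omega> - h) \<partial>M)
      = (\<integral>\<^sup>+\<omega>. ennreal (indicator ?A \<omega> * (X \<omega> - h)) \<partial>M)"
    using int by (intro nn_integral_eq_integral[symmetric]) (auto simp: indicator_def)
  also have "\<dots> = (\<integral>\<^sup>+\<omega>. ennreal (X \<omega> - h) \<partial>M)"
    by (intro nn_integral_cong) (auto simp: indicator_def ennreal_neg)
  finally have "(\<integral>\<omega>. indicator ?A \<omega> * (X \<omega> - h) \<partial>M) \<le> prob ?A * expectation X"
    using le nonneg by (simp add: ennreal_le_iff[symmetric] integral_nonneg_AE)
  moreover have "(LINT \<omega>:?A|M. X \<omega>) = (\<integral>\<omega>. indicator ?A \<omega> * (X \<omega> - h) + h * indicator ?A \<omega> \<partial>M)"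
    unfolding set_lebesgue_integral_def
    by (intro Bochner_Integration.integral_cong) (auto simp: algebra_simps)
  moreover have "\<dots> = (\<integral>\<omega>. indicator ?A \<omega> * (X \<omega> - h) \<partial>M) + h * prob ?A"
    by (subst Bochner_Integration.integral_add[OF int]) (auto simp: emeasure_eq_measure)
  ultimately show ?thesis
    unfolding event_cond_exp_def using pos by (simp add: field_simps)
qed

context prob_space
begin

context
  fixes X :: "'a \<Rightarrow> real" and \<eta> \<gamma> :: real
  assumes X: "distributed M lborel X (\<lambda>t. ennreal (weibull_density \<eta> \<gamma> t))"
    and \<eta>: "0 < \<eta>" and \<gamma>: "0 < \<gamma>"
begin

lemma weibull_tail:
  assumes "0 \<le> t"
  shows "prob {\<omega> \<in> space M. t \<le> X \<omega>} = exp (- ((t / \<eta>) powr \<gamma>))"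
proof -
  have eq: "emeasure M {\<omega> \<in> space M. t \<le> X \<omega>}
      = (\<integral>\<^sup>+x. ennreal (weibull_density \<eta> \<gamma> x) * indicator {t..} x \<partial>lborel)" for t
    using distributed_emeasure[OF X, of "{t..}"] by (simp add: vimage_def Int_def conj_commute)
  show ?thesis
  \<comment> \<open>The power rule needs a positive base, while the fundamental theorem needs a
    derivative at every point of \<open>{t..}\<close>, endpoint included. At 0 the total mass 1 is
    used instead: the density vanishes on the nonpositive reals.\<close>
  proof (cases "t = 0")
    case True
    have "emeasure M {\<omega> \<in> space M. 0 \<le> X \<omega>}
        = (\<integral>\<^sup>+x. ennreal (weibull_density \<eta> \<gamma> x) * indicator UNIV x \<partial>lborel)"
      unfolding eq by (intro nn_integral_cong) (auto simp: indicator_def weibull_density_def)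
    also have "\<dots> = 1"
      using distributed_emeasure[OF X, of UNIV] emeasure_space_1 by simp
    finally show ?thesis
      using True by (simp add: emeasure_eq_measure)
  next
    case False
    \<comment> \<open>The antiderivative is normalised to vanish at infinity, so the tail at
      \<open>t\<close> is \<open>- ?F t\<close>.\<close>
    let ?F = "\<lambda>x. - exp (- ((x / \<eta>) powr \<gamma>))"
    have deriv: "DERIV ?F x :> weibull_density \<eta> \<gamma> x" if "t \<le> x" for x
    proof -
      have "0 < x" "0 < x / \<eta>" using that assms False \<eta> by auto
      moreover have "DERIV (\<lambda>x. x / \<eta>) x :> 1 / \<eta>"
        using \<eta> by (auto intro!: derivative_eq_intros)
      ultimately have "DERIV (\<lambda>x. (x / \<eta>) powr \<gamma>) x :> \<gamma> * (x / \<eta>) powr (\<gamma> - 1) * (1 / \<eta>)"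
        using DERIV_fun_powr[of "\<lambda>x. x / \<eta>" "1 / \<eta>" x \<gamma>] by simp
      from DERIV_minus[OF DERIV_fun_exp[OF DERIV_minus[OF this]]] show ?thesis
        using \<open>0 < x\<close> by (simp add: weibull_density_def mult_ac)
    qed
    have lim: "(?F \<longlongrightarrow> - 0) at_top"
    proof (intro tendsto_minus filterlim_compose[OF exp_at_bot])
      show "LIM x at_top. - ((x / \<eta>) powr \<gamma>) :> at_bot"
        using \<eta> \<gamma> by real_asymp
    qed
    have "emeasure M {\<omega> \<in> space M. t \<le> X \<omega>} = - 0 - ?F t"
      unfolding eq using deriv lim \<eta> \<gamma>
      by (intro nn_integral_FTC_atLeast) (auto simp: weibull_density_def)
    then show ?thesis
      by (simp add: emeasure_eq_measure)
  qed
qed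

lemma weibull_AE_nonneg: "AE \<omega> in M. 0 \<le> X \<omega>"
proof -
  have "AE \<omega> in M. \<omega> \<in> {\<omega> \<in> space M. 0 \<le> X \<omega>}"
    by (rule AE_prob_1) (simp add: weibull_tail)
  then show ?thesis
    by eventually_elim simp
qed

text \<open>With \<open>u = t / \<eta>\<close>, the bound \<open>u \<le> 1 + u powr \<gamma>\<close>
  (trivial for \<open>u \<le> 1\<close>, and from \<open>u \<le> u powr \<gamma>\<close> otherwise)
  puts the tail below \<open>exp (1 - u)\<close>, whose integral over the half-line is
  \<open>\<eta> * exp 1\<close>.\<close>

lemma weibull_integrable:
  assumes "1 \<le> \<gamma>"
  shows "integrable M X"
proof (rule integrableI_nonneg)
  show meas [measurable]: "random_variable borel X"
    using distributed_measurable[OF X] by simp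
  show "AE \<omega> in M. 0 \<le> X \<omega>"
    by (rule weibull_AE_nonneg)
  have bound: "- ((t / \<eta>) powr \<gamma>) \<le> 1 - t / \<eta>" if "0 \<le> t" for t
  proof -
    have "t / \<eta> \<le> 1 + (t / \<eta>) powr \<gamma>"
    proof (cases "t / \<eta> \<le> 1")
      case False
      then show ?thesis
        using powr_mono[of 1 \<gamma> "t / \<eta>"] assms that \<eta> by (simp del: powr_one_eq_one)
    qed (simp add: add_increasing2)
    then show ?thesis by simp
  qed
  have "(\<integral>\<^sup>+\<omega>. ennreal (X \<omega>) \<partial>M)
      = (\<integral>\<^sup>+t. ennreal (prob {\<omega> \<in> space M. 0 + t \<le> X \<omega>}) * indicator {0..} t \<partial>lborel)"
    using nn_integral_excess_eq_tail[OF meas, of 0] by simp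
  also have "\<dots> \<le> (\<integral>\<^sup>+t. ennreal (exp (1 - t / \<eta>)) * indicator {0..} t \<partial>lborel)"
    by (intro nn_integral_mono)
      (auto simp: indicator_def weibull_tail intro!: ennreal_leI bound)
  also have "\<dots> = ennreal (0 - (- \<eta> * exp (1 - 0 / \<eta>)))"
  proof (rule nn_integral_FTC_atLeast)
    show "((\<lambda>x. - \<eta> * exp (1 - x / \<eta>)) has_real_derivative exp (1 - x / \<eta>)) (at x)" for x
      using \<eta> by (auto intro!: derivative_eq_intros)
    show "((\<lambda>x. - \<eta> * exp (1 - x / \<eta>)) \<longlongrightarrow> 0) at_top"
      using \<eta> by real_asymp
  qed auto
  finally show "(\<integral>\<^sup>+\<omega>. ennreal (X \<omega>) \<partial>M) < \<infinity>"
    by (rule le_less_trans) simp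
qed

end

end

theorem proposition4p1:
  fixes M :: "'a measure" and X :: "'a \<Rightarrow> real" and \<eta> \<gamma> h :: real
  assumes "prob_space M"
    and "distributed M lborel X (\<lambda>t. ennreal (weibull_density \<eta> \<gamma> t))"
    and "\<eta> > 0" and "1 < \<gamma>" and "\<gamma> < 2"
    and "h \<ge> 0"
  shows "event_cond_exp M X {\<omega> \<in> space M. X \<omega> \<ge> h} \<le> integral\<^sup>L M X + h"
proof -
  interpret prob_space M by fact
  have \<gamma>: "0 < \<gamma>" using assms by simp
  note tail = weibull_tail[OF assms(2,3) \<gamma>]
  show ?thesis
  proof (rule event_cond_exp_le_if_tail_submultiplicative)
    show "integrable M X"
      using weibull_integrable[OF assms(2,3) \<gamma>] assms by simp
    show "AE \<omega> in M. 0 \<le> X \<omega>"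
      by (rule weibull_AE_nonneg[OF assms(2,3) \<gamma>])
    show "0 < prob {\<omega> \<in> space M. h \<le> X \<omega>}"
      using assms by (simp add: tail)
    show "prob {\<omega> \<in> space M. h + t \<le> X \<omega>}
        \<le> prob {\<omega> \<in> space M. h \<le> X \<omega>} * prob {\<omega> \<in> space M. t \<le> X \<omega>}" if "0 \<le> t" for t
      \<comment> \<open>The product of the two tails is a single exponential of minus the sum of the
        powers, so superadditivity of the exponents is exactly what is required.\<close>
      using powr_superadditive[of "h / \<eta>" "t / \<eta>" \<gamma>] that assms
      by (simp add: tail exp_add[symmetric] add_divide_distrib)
  qed
qed

end
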